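(* Let $f(n)$ be an arithmetic function for which a (nonlinear) asymptotic with a remainder term is known: $$\sum_{n\le x} f(n)=g_1(x)+O(g_2(x)),\qquad x\to\infty.$$ Then, for $s\ge 1$, $$\sum_{n\le x} n^s f(n)=x^s g_1(x)+O(x^s g_2(x))-s\int_1^x g_1(t)\,dt+O\left(\int_1^x g_2(t)\,t^{s-1}\,dt\right),\qquad x\to\infty.$$
   Context: An arithmetic function is a function defined on the positive integers with complex values. Sums $\sum_{n\le x}$ run over positive integers $n\le x$. Here $g_1$ is the function giving the main term and $g_2$ the function in the remainder term. An asymptotic of the form $\sum_{n\le x} f(n)=cx+o(x)$ with $c$ a constant is called linear; other asymptotics are called nonlinear. $O(\cdot)$ is the usual Landau symbol as $x\to\infty$.
   Formalization: The main integral is taken as s∫_1^x g_1(t)t^{s-1}dt, since the printed s∫_1^x g_1(t)dt fails for s>1 (f(n)=n, s=2); g_1, g_2 are assumed integrable on each [1,x], and g_2 nonnegative on [1,∞) and not almost everywhere zero there. *)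

theory Defs
  imports "HOL-Analysis.Analysis" "HOL-Library.Landau_Symbols"
begin

end

theory Submission
  imports Defs
begin

text \<open>
  Writing $n^s = x^s - s\int_n^x t^{s-1}\,dt$ and summing over $n \le x$ gives Abel's formula
  $\sum_{n\le x} n^s f(n) = x^s F(x) - s\int_1^x F(t)\,t^{s-1}\,dt$ with $F(x) = \sum_{n\le x} f(n)$.
  Splitting $F = g_1 + R$ produces the two error terms. The contribution to $\int_1^x R(t)\,t^{s-1}\,dt$
  of the bounded segment on which $R = O(g_2)$ is not yet effective is a constant, absorbed by
  $\int_1^x g_2(t)\,t^{s-1}\,dt$ because the latter is eventually bounded below by a positive number.
\<close>

lemma has_integral_powr:
  fixes a x s :: real
  assumes "0 < a" "a \<le> x"
  shows "((\<lambda>t. complex_of_real s * complex_of_real (t powr (s - 1))) has_integral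
           complex_of_real (x powr s) - complex_of_real (a powr s)) {a..x}"
proof (rule fundamental_theorem_of_calculus[OF assms(2)])
  fix t assume "t \<in> {a..x}"
  then have "((\<lambda>t. t powr s) has_real_derivative s * t powr (s - 1)) (at t within {a..x})"
    using assms by (auto intro!: derivative_eq_intros)
  from has_vector_derivative_of_real[OF this]
  show "((\<lambda>t. complex_of_real (t powr s)) has_vector_derivative
          complex_of_real s * complex_of_real (t powr (s - 1))) (at t within {a..x})"
    by simp
qed

text \<open>No integration by parts is needed: for each n <= x the weight is integrated over [n, x]
  and extended by zero to [1, x], and the finite sum over n is exchanged with the integral. The
  \<open>has_integral\<close> form also delivers integrability of the weighted partial sums, which
  is used later.\<close>

lemma abel_summation_powr:
  fixes f :: "nat \<Rightarrow> complex" and s x :: real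
  assumes "x \<ge> 1"
  shows "((\<lambda>t. complex_of_real s * ((\<Sum>n | 1 \<le> n \<and> real n \<le> t. f n) * complex_of_real (t powr (s - 1))))
           has_integral complex_of_real (x powr s) * (\<Sum>n | 1 \<le> n \<and> real n \<le> x. f n)
             - (\<Sum>n | 1 \<le> n \<and> real n \<le> x. complex_of_real (real n powr s) * f n)) {1..x}"
proof -
  let ?A = "\<lambda>t. {n. 1 \<le> n \<and> real n \<le> t}"
  let ?k = "\<lambda>t. complex_of_real s * complex_of_real (t powr (s - 1))"
  have fin: "finite (?A t)" for t
    by (rule finite_subset[of _ "{..nat \<lfloor>t\<rfloor>}"]) (auto simp: le_nat_floor)
  have "((\<lambda>t. \<Sum>n\<in>?A x. f n * (if t \<in> {real n..x} then ?k t else 0)) has_integral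
          (\<Sum>n\<in>?A x. f n * (complex_of_real (x powr s) - complex_of_real (real n powr s)))) {1..x}"
  proof (intro has_integral_sum fin has_integral_mult_right)
    fix n assume "n \<in> ?A x"
    then have "{real n..x} \<subseteq> {1..x}" "(?k has_integral
        complex_of_real (x powr s) - complex_of_real (real n powr s)) {real n..x}"
      by (auto intro!: has_integral_powr)
    then show "((\<lambda>t. if t \<in> {real n..x} then ?k t else 0) has_integral
        complex_of_real (x powr s) - complex_of_real (real n powr s)) {1..x}"
      by (subst has_integral_restrict)
  qed
  \<comment> \<open>At a fixed t the terms with n > t vanish, so the sum over n <= x collapses to
    the partial sum up to t.\<close>
  moreover have "(\<Sum>n\<in>?A x. f n * (if t \<in> {real n..x} then ?k t else 0)) =
      complex_of_real s * ((\<Sum>n\<in>?A t. f n) * complex_of_real (t powr (s - 1)))" if "t \<in> {1..x}" for t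
  proof -
    have "(\<Sum>n\<in>?A x. f n * (if t \<in> {real n..x} then ?k t else 0)) = (\<Sum>n\<in>?A t. f n * ?k t)"
      using that by (intro sum.mono_neutral_cong_right fin) auto
    then show ?thesis by (simp add: sum_distrib_right sum_distrib_left algebra_simps)
  qed
  ultimately have "((\<lambda>t. complex_of_real s * ((\<Sum>n\<in>?A t. f n) * complex_of_real (t powr (s - 1)))) has_integral
          (\<Sum>n\<in>?A x. f n * (complex_of_real (x powr s) - complex_of_real (real n powr s)))) {1..x}"
    by (rule has_integral_eq[rotated])
  then show ?thesis
    by (simp add: sum_distrib_left sum_subtractf algebra_simps)
qed

text \<open>
  The integrals are non-absolute, so boundedness of the weight would not suffice here; the second
  mean value theorem supplies integrability for monotone weights.
\<close>
lemma integrable_mono_mult: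
  fixes g :: "real \<Rightarrow> 'a::euclidean_space" and w :: "real \<Rightarrow> real"
  assumes g: "g integrable_on {a..b}"
    and w: "\<And>x y. a \<le> x \<Longrightarrow> x \<le> y \<Longrightarrow> y \<le> b \<Longrightarrow> w x \<le> w y"
  shows "(\<lambda>t. w t *\<^sub>R g t) integrable_on {a..b}"
proof (cases "a \<le> b")
  case True
  show ?thesis
  proof (rule integrable_componentwise)
    fix i :: 'a assume "i \<in> Basis"
    then have "(\<lambda>t. g t \<bullet> i) integrable_on {a..b}"
      using g integrable_componentwise_iff by blast
    \<comment> \<open>The second mean value theorem is a statement about real-valued functions,
      hence the passage to components. Its conclusion is used only for the existence of the
      integral; the point \<open>c\<close> and the value are discarded.\<close>
    then obtain c where "((\<lambda>t. w t * (g t \<bullet> i)) has_integral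
        (w a * integral {a..c} (\<lambda>t. g t \<bullet> i) + w b * integral {c..b} (\<lambda>t. g t \<bullet> i))) {a..b}"
      by (rule second_mean_value_theorem_full[OF _ True w])
    then show "(\<lambda>t. (w t *\<^sub>R g t) \<bullet> i) integrable_on {a..b}"
      by (auto simp: integrable_on_def)
  qed
qed auto

text \<open>Beyond some M the pointwise bound can be integrated. What remains, the integral of
  \<open>h\<close> over [a, M], is a constant, and it is at most a multiple of the integral of
  \<open>k\<close>, which is nondecreasing in x and already positive at \<open>x0\<close>.\<close>

lemma integral_bigo_integral:
  fixes h :: "real \<Rightarrow> 'a::{euclidean_space, real_normed_field}" and k :: "real \<Rightarrow> real"
  assumes h: "\<And>x. x \<ge> a \<Longrightarrow> h integrable_on {a..x}"
    and k: "\<And>x. x \<ge> a \<Longrightarrow> k integrable_on {a..x}"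
    and nonneg: "\<And>x. x \<ge> a \<Longrightarrow> k x \<ge> 0"
    and pos: "x0 \<ge> a" "integral {a..x0} k > 0"
    and bigo: "h \<in> O[at_top](\<lambda>x. of_real (k x))"
  shows "(\<lambda>x. integral {a..x} h) \<in> O[at_top](\<lambda>x. of_real (integral {a..x} k))"
proof -
  obtain C where C: "C > 0" "\<forall>\<^sub>F x in at_top. norm (h x) \<le> C * norm (of_real (k x) :: 'a)"
    using landau_o.bigE[OF bigo] by blast
  then obtain N where N: "\<And>x. x \<ge> N \<Longrightarrow> norm (h x) \<le> C * norm (of_real (k x) :: 'a)"
    by (auto simp: eventually_at_top_linorder)
  define M where "M = max N a"
  have M: "M \<ge> a" "\<And>x. x \<ge> M \<Longrightarrow> norm (h x) \<le> C * k x"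
    using N nonneg by (force simp: M_def)+
  let ?I = "\<lambda>x. integral {a..x} k"
  \<comment> \<open>In the constant, the quotient pays for [a, M] and \<open>C\<close> pays for
    [M, x].\<close>
  have "norm (integral {a..x} h) \<le> (norm (integral {a..M} h) / ?I x0 + C) * norm (of_real (?I x) :: 'a)"
    if x: "x \<ge> max M x0" for x
  proof -
    have sub: "h integrable_on {M..x}" "k integrable_on {M..x}"
      using M(1) x h[of x] k[of x] by (auto intro: integrable_subinterval_real)
    have Ix0: "?I x0 \<le> ?I x"
      using x pos k nonneg by (intro integral_subset_le) auto
    have IM: "integral {M..x} k \<le> ?I x"
      using x M pos k sub nonneg by (intro integral_subset_le) auto
    have "norm (integral {a..x} h) \<le> norm (integral {a..M} h) + norm (integral {M..x} h)"
      using Henstock_Kurzweil_Integration.integral_combine[of a M x h] M(1) x h[of x] norm_triangle_ineq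
      by (metis max.bounded_iff order_trans)
    also have "norm (integral {M..x} h) \<le> integral {M..x} (\<lambda>t. C * k t)"
      using sub M(2) by (intro Henstock_Kurzweil_Integration.integral_norm_bound_integral)
         (auto intro: integrable_on_mult_right)
    also have "\<dots> \<le> C * ?I x"
      using IM C(1) by simp
    also have "norm (integral {a..M} h) \<le> norm (integral {a..M} h) / ?I x0 * ?I x"
      using mult_left_mono[OF Ix0, of "norm (integral {a..M} h) / ?I x0"] pos(2) by simp
    finally show ?thesis
      using Ix0 pos(2) by (simp add: algebra_simps)
  qed
  then show ?thesis
    by (intro bigoI eventually_at_top_linorderI)
qed

text \<open>The integral of \<open>g1\<close> carries the weight t^(s-1) produced by Abel summation:
  for f = 1, g1(x) = x and s = 2 the main terms are then x^3 - 2(x^3 - 1)/3, in agreement with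
  x^3/3. The error terms are explicit functions \<open>E1\<close> and \<open>E2\<close>, so the
  identity is exact for every x >= 1 and only their bounds are asymptotic.\<close>

theorem mainTheorem5:
  fixes f :: "nat \<Rightarrow> complex" and g1 :: "real \<Rightarrow> complex" and g2 :: "real \<Rightarrow> real" and s :: real
  assumes g1_integrable: "\<And>x. x \<ge> 1 \<Longrightarrow> g1 integrable_on {1..x}"
    and g2_integrable: "\<And>x. x \<ge> 1 \<Longrightarrow> g2 integrable_on {1..x}"
    and g2_nonneg: "\<And>x. x \<ge> 1 \<Longrightarrow> g2 x \<ge> 0"
    and g2_nontrivial: "\<exists>x\<ge>1. integral {1..x} g2 > 0"
    and asymptotic: "(\<lambda>x. (\<Sum>n | 1 \<le> n \<and> real n \<le> x. f n) - g1 x)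
                       \<in> O[at_top](\<lambda>x. complex_of_real (g2 x))"
    and s: "s \<ge> 1"
  shows "\<exists>E1 E2 :: real \<Rightarrow> complex.
           E1 \<in> O[at_top](\<lambda>x. complex_of_real (x powr s * g2 x)) \<and>
           E2 \<in> O[at_top](\<lambda>x. complex_of_real (integral {1..x} (\<lambda>t. g2 t * t powr (s - 1)))) \<and>
           (\<forall>x\<ge>1. (\<Sum>n | 1 \<le> n \<and> real n \<le> x. complex_of_real (real n powr s) * f n) =
              complex_of_real (x powr s) * g1 x + E1 x
              - complex_of_real s * integral {1..x} (\<lambda>t. g1 t * complex_of_real (t powr (s - 1)))
              + E2 x)"
proof -
  let ?F = "\<lambda>x. \<Sum>n | 1 \<le> n \<and> real n \<le> x. f n"
  let ?S = "\<lambda>x. \<Sum>n | 1 \<le> n \<and> real n \<le> x. complex_of_real (real n powr s) * f n"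
  let ?w = "\<lambda>t. complex_of_real (t powr (s - 1))"
  define R where "R x = ?F x - g1 x" for x
  have w_mono: "x powr (s - 1) \<le> y powr (s - 1)" if "1 \<le> x" "x \<le> y" for x y :: real
    using that s by (intro powr_mono2) auto
  have Fw: "((\<lambda>t. ?F t * ?w t) has_integral
      (complex_of_real (x powr s) * ?F x - ?S x) / complex_of_real s) {1..x}" if "x \<ge> 1" for x
    using has_integral_mult_right[OF abel_summation_powr[OF that, where f = f and s = s],
        of "1 / complex_of_real s"] s
    by simp
  have g1w: "(\<lambda>t. g1 t * ?w t) integrable_on {1..x}" if "x \<ge> 1" for x
    using integrable_mono_mult[OF g1_integrable[OF that], of "\<lambda>t. t powr (s - 1)"] w_mono
    by (simp add: scaleR_conv_of_real mult.commute)
  have g2w: "(\<lambda>t. g2 t * t powr (s - 1)) integrable_on {1..x}" if "x \<ge> 1" for x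
    using integrable_mono_mult[OF g2_integrable[OF that], of "\<lambda>t. t powr (s - 1)"] w_mono
    by (simp add: mult.commute)
  \<comment> \<open>The bound on \<open>R\<close> holds only for large arguments and does not give
    integrability; this comes from writing \<open>R\<close> as the partial sum minus
    \<open>g1\<close>.\<close>
  have Rw: "(\<lambda>t. R t * ?w t) integrable_on {1..x}" if "x \<ge> 1" for x
    using integrable_diff[OF has_integral_integrable[OF Fw[OF that]] g1w[OF that]]
    by (simp add: R_def algebra_simps)
  obtain x0 where x0: "x0 \<ge> 1" "integral {1..x0} g2 > 0"
    using g2_nontrivial by blast
  \<comment> \<open>Since s >= 1, the weight is at least 1 on [1, x0], so positivity passes to the
    weighted integral at the same \<open>x0\<close>.\<close>
  have "integral {1..x0} g2 \<le> integral {1..x0} (\<lambda>t. g2 t * t powr (s - 1))"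
  proof (rule integral_le[OF g2_integrable g2w])
    fix t assume "t \<in> {1..x0}"
    then show "g2 t \<le> g2 t * t powr (s - 1)"
      using mult_left_mono[of 1 "t powr (s - 1)" "g2 t"] g2_nonneg s by (auto simp: ge_one_powr_ge_zero)
  qed (use x0 in auto)
  with x0 have pos: "integral {1..x0} (\<lambda>t. g2 t * t powr (s - 1)) > 0"
    by linarith
  have R: "R \<in> O[at_top](\<lambda>x. complex_of_real (g2 x))"
    using asymptotic by (simp add: R_def[abs_def])
  define E1 where "E1 x = complex_of_real (x powr s) * R x" for x
  define E2 where "E2 x = - complex_of_real s * integral {1..x} (\<lambda>t. R t * ?w t)" for x
  have "E1 \<in> O[at_top](\<lambda>x. complex_of_real (x powr s * g2 x))"
    unfolding E1_def[abs_def] using landau_o.big.mult[OF landau_o.big_refl R] by simp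
  moreover have "E2 \<in> O[at_top](\<lambda>x. complex_of_real (integral {1..x} (\<lambda>t. g2 t * t powr (s - 1))))"
  proof -
    have "(\<lambda>t. R t * ?w t) \<in> O[at_top](\<lambda>t. complex_of_real (g2 t * t powr (s - 1)))"
      using landau_o.big.mult[OF R landau_o.big_refl] by simp
    from integral_bigo_integral[OF Rw g2w _ x0(1) pos this]
    have "(\<lambda>x. integral {1..x} (\<lambda>t. R t * ?w t)) \<in>
        O[at_top](\<lambda>x. complex_of_real (integral {1..x} (\<lambda>t. g2 t * t powr (s - 1))))"
      using g2_nonneg by simp
    then show ?thesis
      unfolding E2_def[abs_def] using s by simp
  qed
  moreover have "?S x = complex_of_real (x powr s) * g1 x + E1 x
      - complex_of_real s * integral {1..x} (\<lambda>t. g1 t * ?w t) + E2 x" if "x \<ge> 1" for x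
  proof -
    have "integral {1..x} (\<lambda>t. ?F t * ?w t)
        = integral {1..x} (\<lambda>t. g1 t * ?w t + R t * ?w t)"
      by (simp add: R_def algebra_simps)
    also have "\<dots> = integral {1..x} (\<lambda>t. g1 t * ?w t) + integral {1..x} (\<lambda>t. R t * ?w t)"
      by (rule integral_add[OF g1w Rw]) (use that in auto)
    finally have "complex_of_real s * (integral {1..x} (\<lambda>t. g1 t * ?w t) + integral {1..x} (\<lambda>t. R t * ?w t))
        = complex_of_real (x powr s) * ?F x - ?S x"
      using integral_unique[OF Fw[OF that]] s by simp
    moreover have "complex_of_real (x powr s) * ?F x = complex_of_real (x powr s) * g1 x + E1 x"
      by (simp add: E1_def R_def algebra_simps)
    ultimately show ?thesis
      by (simp add: E2_def algebra_simps)
  qed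
  ultimately show ?thesis
    by blast
qed

end
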